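(* Consider the planar discrete dynamical system $$x_{n+1}=\lambda_1x_n+f(x_n,y_n),\qquad y_{n+1}=\lambda_2y_n+g(x_n,y_n),$$ where $\lambda_1=\pm1$, $|\lambda_2|<1$, and $f,g$ are real functions of class $C^{r}$ on a neighbourhood of the origin with $f(0,0)=g(0,0)=0$ and $Df(0,0)=Dg(0,0)=0$. Let $y=h(x)$ be a $C^{r}$ center manifold of the fixed point $(0,0)$, and let the restriction of the system to this center manifold be given by $$x\mapsto G(x)=\lambda_1x+f(x,h(x)).$$ Let $S(x_1,y_1)=(x_n,y_n)_{n\ge1}$ be an orbit of the system on the center manifold, $$x_{n+1}=\lambda_1x_n+f(x_n,h(x_n)),\qquad y_{n+1}=h(x_{n+1}),$$ with initial point $(x_1,y_1)$ (on the center manifold) near $(0,0)$. If $G$ is $k$-nondegenerate at $x=0$, then there exists $r>0$ such that for $|x_1|<r$ $$\dim_B S(x_1,y_1)=1-\frac1k .$$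
   Context: Box dimension: for a bounded set $A\subset\mathbb{R}^N$ let $A_\varepsilon=\{y\in\mathbb{R}^N: d(y,A)<\varepsilon\}$, with Lebesgue measure $|A_\varepsilon|$. For $s\ge0$ the lower and upper $s$-dimensional Minkowski contents are $\mathcal{M}_*^s(A)=\liminf_{\varepsilon\to0}|A_\varepsilon|/\varepsilon^{N-s}$ and $\mathcal{M}^{*s}(A)=\limsup_{\varepsilon\to0}|A_\varepsilon|/\varepsilon^{N-s}$. The lower and upper box dimensions are $\underline{\dim}_BA=\inf\{s>0:\mathcal{M}_*^s(A)=0\}$ and $\overline{\dim}_BA=\inf\{s>0:\mathcal{M}^{*s}(A)=0\}$; if they coincide the common value is $\dim_BA$. The box dimension of an orbit is that of the set of its points. Nondegeneracy: let $F:(x_0-\rho,x_0+\rho)\to\mathbb{R}$ be of class $C^k$ with fixed point $x_0$ and $F'(x_0)\ne0$. If $k\ge3$, $F''(x_0)=\dots=F^{(k-1)}(x_0)=0$ and $F^{(k)}(x_0)\neq0$, then $F$ is called $k$-nondegenerate at $x_0$; if $F''(x_0)\ne0$, $F$ is called $2$-nondegenerate at $x_0$. A center manifold here is a locally invariant curve $y=h(x)$ with $h(0)=0$, $h'(0)=0$. The radius $r>0$ in the conclusion is unrelated to the smoothness class $C^{r}$.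
   Formalization: Added: the orbit starts on the attracting side, |G(x_1)|<|x_1| (for x_1=0 the dimension is 0, and on the repelling side the orbit leaves the neighbourhood of the origin), and k is odd if λ_1=-1 (for G(x)=-x+x^2 the dimension is 2/3, not 1/2). *)

theory Defs
  imports "HOL-Analysis.Analysis"
begin

text \<open>Class $C^k$ on an open set, in finite dimension: every directional derivative is again of
  class $C^{k-1}$. The definition is only meaningful for open \<open>S\<close>, since the derivative is
  taken at \<open>x\<close> and not at \<open>x\<close> within \<open>S\<close>.\<close>

primrec Ck_on :: "nat \<Rightarrow> ('a::euclidean_space \<Rightarrow> real) \<Rightarrow> 'a set \<Rightarrow> bool" where
  "Ck_on 0 F S \<longleftrightarrow> continuous_on S F"
| "Ck_on (Suc k) F S \<longleftrightarrow>
     (\<forall>x\<in>S. F differentiable (at x)) \<and>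
     (\<forall>v. Ck_on k (\<lambda>x. frechet_derivative F (at x) v) S)"

definition nondegenerate_at :: "nat \<Rightarrow> (real \<Rightarrow> real) \<Rightarrow> real \<Rightarrow> bool" where
  "nondegenerate_at k F x0 \<longleftrightarrow>
     2 \<le> k \<and>
     (\<exists>\<rho>>0. Ck_on k F {x0 - \<rho><..<x0 + \<rho>}) \<and>
     F x0 = x0 \<and>
     deriv F x0 \<noteq> 0 \<and>
     (\<forall>i. 2 \<le> i \<and> i < k \<longrightarrow> (deriv ^^ i) F x0 = 0) \<and>
     (deriv ^^ k) F x0 \<noteq> 0"

definition planar_map ::
  "real \<Rightarrow> real \<Rightarrow> (real \<times> real \<Rightarrow> real) \<Rightarrow> (real \<times> real \<Rightarrow> real) \<Rightarrow> real \<times> real \<Rightarrow> real \<times> real" where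
  "planar_map l1 l2 f g = (\<lambda>(x, y). (l1 * x + f (x, y), l2 * y + g (x, y)))"

text \<open>Local invariance of the curve \<open>y = h x\<close>, \<open>\<bar>x\<bar> < \<delta>\<close>, means that \<open>\<Phi>\<close> maps its points
  close to the origin to points of the curve; points further away may leave the curve
  through its ends.\<close>

definition local_center_manifold ::
  "nat \<Rightarrow> (real \<times> real \<Rightarrow> real \<times> real) \<Rightarrow> real \<Rightarrow> (real \<Rightarrow> real) \<Rightarrow> bool" where
  "local_center_manifold r \<Phi> \<delta> h \<longleftrightarrow>
     0 < \<delta> \<and>
     Ck_on r h {-\<delta><..<\<delta>} \<and>
     h 0 = 0 \<and>
     (h has_real_derivative 0) (at 0) \<and>
     (let M = (\<lambda>x. (x, h x)) ` {-\<delta><..<\<delta>}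
      in \<exists>W. open W \<and> (0, 0) \<in> W \<and> \<Phi> ` (M \<inter> W) \<subseteq> M)"

text \<open>The first conjunct is needed because \<open>infdist y {} = 0\<close>, whereas the distance to the
  empty set is infinite.\<close>

definition eps_nbhd :: "real \<Rightarrow> 'a::metric_space set \<Rightarrow> 'a set" where
  "eps_nbhd \<epsilon> A = {y. A \<noteq> {} \<and> infdist y A < \<epsilon>}"

definition lower_minkowski_content :: "real \<Rightarrow> 'a::euclidean_space set \<Rightarrow> ennreal" where
  "lower_minkowski_content s A =
     Liminf (at_right 0)
       (\<lambda>\<epsilon>. emeasure lborel (eps_nbhd \<epsilon> A) / ennreal (\<epsilon> powr (real DIM('a) - s)))"

definition upper_minkowski_content :: "real \<Rightarrow> 'a::euclidean_space set \<Rightarrow> ennreal" where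
  "upper_minkowski_content s A =
     Limsup (at_right 0)
       (\<lambda>\<epsilon>. emeasure lborel (eps_nbhd \<epsilon> A) / ennreal (\<epsilon> powr (real DIM('a) - s)))"

text \<open>For bounded \<open>A\<close> both contents vanish for every \<open>s\<close> greater than the dimension of the
  space, so the infima below are over nonempty sets.\<close>

definition lower_box_dim :: "'a::euclidean_space set \<Rightarrow> real" where
  "lower_box_dim A = Inf {s. 0 < s \<and> lower_minkowski_content s A = 0}"

definition upper_box_dim :: "'a::euclidean_space set \<Rightarrow> real" where
  "upper_box_dim A = Inf {s. 0 < s \<and> upper_minkowski_content s A = 0}"

definition has_box_dim :: "'a::euclidean_space set \<Rightarrow> real \<Rightarrow> bool" where
  "has_box_dim A d \<longleftrightarrow> bounded A \<and> lower_box_dim A = d \<and> upper_box_dim A = d"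

end

theory Submission
  imports Defs
begin

text \<open>The orbit is governed by the one-dimensional map \<open>G\<close>, and on the center manifold it is the graph of
  \<open>h\<close> over the orbit \<open>x\<^sub>n\<close> of \<open>G\<close>. As \<open>h\<close> is Lipschitz near 0, the planar orbit has the dimension of its
  projection, so the problem is to count points of \<open>x\<^sub>n\<close> at a given scale.

  Taylor's formula (\<open>nondegenerate_at_0_expansion\<close>) gives \<open>G x = \<lambda>\<^sub>1 x + q x\<^sup>k\<close> with \<open>q\<close> comparable to a
  nonzero constant \<open>b\<close>. If the initial point satisfies \<open>\<bar>G x\<bar> < \<bar>x\<bar>\<close>, then the sign of \<open>\<lambda>\<^sub>1 b x\<^sup>k\<^sup>-\<^sup>1\<close> is
  negative there, and it is preserved by \<open>G\<close> (\<open>near_identity_step\<close>): for \<open>\<lambda>\<^sub>1 = 1\<close> because the orbit stays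
  on one side of 0, for \<open>\<lambda>\<^sub>1 = -1\<close> because \<open>k - 1\<close> is even. Hence the absolute values \<open>u\<^sub>n = \<bar>x\<^sub>n\<bar>\<close> decrease,
  with \<open>u\<^sub>n - u\<^sub>n\<^sub>+\<^sub>1\<close> comparable to \<open>u\<^sub>n\<^sup>k\<close>; this is the situation of the locale \<open>power_decay\<close>, with
  \<open>m = k - 1\<close>.

  For such a sequence \<open>1 / u\<^sub>n\<^sup>m\<close> grows linearly (\<open>inverse_power_bounds\<close>), and the gaps fall below
  \<open>\<epsilon> = e\<^sup>k\<close> about when \<open>u\<^sub>n\<close> falls below \<open>e\<close>. So there are of the order of \<open>1 / e\<^sup>m\<close> points that are well
  separated at scale \<open>\<epsilon>\<close>, while the remaining ones lie on an arc of length about \<open>e\<close>, for which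
  \<open>e / \<epsilon> = 1 / e\<^sup>m\<close> balls suffice. The lemmas \<open>graph_covering\<close> and \<open>graph_packing\<close> turn this into matching
  bounds for the area of the \<open>\<epsilon>\<close>-neighbourhood, namely constants times \<open>\<epsilon>\<^sup>2 / e\<^sup>m\<close>, which is \<open>\<epsilon>\<close> to the power
  \<open>2 - (1 - 1/k)\<close>; by \<open>has_box_dim_if_volume_comparable\<close> the box dimension is \<open>1 - 1/k\<close>.\<close>

section \<open>Box dimension from covering and packing numbers\<close>

lemma eps_nbhd_eq_Union_balls: "eps_nbhd \<epsilon> A = (\<Union>a\<in>A. ball a \<epsilon>)"
proof (cases "A = {}")
  case False
  then show ?thesis
    unfolding eps_nbhd_def infdist_def
    by (auto simp: cINF_less_iff dist_commute)
qed (simp add: eps_nbhd_def)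

text \<open>If every point of \<open>A\<close> is within \<open>\<delta>\<close> of \<open>P\<close>, then by the triangle inequality the balls of radius
  \<open>\<epsilon> + \<delta>\<close> around \<open>P\<close> cover the \<open>\<epsilon>\<close>-neighbourhood of \<open>A\<close>, and volume is subadditive.\<close>

lemma emeasure_eps_nbhd_le_covering:
  fixes A P :: "'a::euclidean_space set"
  assumes "finite P" "0 \<le> \<epsilon>" "0 \<le> \<delta>" and cover: "\<And>a. a \<in> A \<Longrightarrow> \<exists>p\<in>P. dist a p \<le> \<delta>"
  shows "emeasure lborel (eps_nbhd \<epsilon> A)
           \<le> ennreal (real (card P) * (unit_ball_vol (real DIM('a)) * (\<epsilon> + \<delta>) ^ DIM('a)))"
proof -
  have "eps_nbhd \<epsilon> A \<subseteq> (\<Union>p\<in>P. ball p (\<epsilon> + \<delta>))"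
  proof
    fix y assume "y \<in> eps_nbhd \<epsilon> A"
    then obtain a where a: "a \<in> A" "dist a y < \<epsilon>"
      by (auto simp: eps_nbhd_eq_Union_balls)
    with cover obtain p where "p \<in> P" "dist a p \<le> \<delta>" by blast
    moreover have "dist p y \<le> dist a p + dist a y"
      by (metis dist_commute dist_triangle)
    ultimately show "y \<in> (\<Union>p\<in>P. ball p (\<epsilon> + \<delta>))"
      using a by force
  qed
  then have "emeasure lborel (eps_nbhd \<epsilon> A) \<le> emeasure lborel (\<Union>p\<in>P. ball p (\<epsilon> + \<delta>))"
    by (intro emeasure_mono) (auto intro: borel_open)
  also have "\<dots> \<le> (\<Sum>p\<in>P. emeasure lborel (ball p (\<epsilon> + \<delta>)))"
    using \<open>finite P\<close> by (intro emeasure_subadditive_finite) auto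
  also have "\<dots> = ennreal (real (card P) * (unit_ball_vol (real DIM('a)) * (\<epsilon> + \<delta>) ^ DIM('a)))"
    using assms by (simp add: emeasure_ball ennreal_mult'' ennreal_of_nat_eq_real_of_nat)
  finally show ?thesis .
qed

text \<open>Around points that are \<open>2\<epsilon>\<close>-separated the balls of radius \<open>\<epsilon>\<close> are disjoint, so their volumes add up.\<close>

lemma emeasure_eps_nbhd_ge_packing:
  fixes A P :: "'a::euclidean_space set"
  assumes "finite P" "P \<subseteq> A" "0 \<le> \<epsilon>"
    and sep: "\<And>p q. p \<in> P \<Longrightarrow> q \<in> P \<Longrightarrow> p \<noteq> q \<Longrightarrow> 2 * \<epsilon> \<le> dist p q"
  shows "ennreal (real (card P) * (unit_ball_vol (real DIM('a)) * \<epsilon> ^ DIM('a)))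
           \<le> emeasure lborel (eps_nbhd \<epsilon> A)"
proof -
  have "disjoint_family_on (\<lambda>p. ball p \<epsilon>) P"
    unfolding disjoint_family_on_def
  proof safe
    fix p q y assume pq: "p \<in> P" "q \<in> P" "p \<noteq> q" and y: "y \<in> ball p \<epsilon>" "y \<in> ball q \<epsilon>"
    have "dist p q \<le> dist p y + dist q y"
      by (metis dist_commute dist_triangle)
    with sep[OF pq] y show "y \<in> {}" by simp
  qed
  then have "emeasure lborel (\<Union>p\<in>P. ball p \<epsilon>) = (\<Sum>p\<in>P. emeasure lborel (ball p \<epsilon>))"
    using \<open>finite P\<close> by (intro sum_emeasure [symmetric]) auto
  also have "\<dots> = ennreal (real (card P) * (unit_ball_vol (real DIM('a)) * \<epsilon> ^ DIM('a)))"
    using assms by (simp add: emeasure_ball ennreal_mult'' ennreal_of_nat_eq_real_of_nat)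
  finally have "ennreal (real (card P) * (unit_ball_vol (real DIM('a)) * \<epsilon> ^ DIM('a)))
      = emeasure lborel (\<Union>p\<in>P. ball p \<epsilon>)" ..
  also have "\<dots> \<le> emeasure lborel (eps_nbhd \<epsilon> A)"
    using \<open>P \<subseteq> A\<close> by (intro emeasure_mono) (auto simp: eps_nbhd_eq_Union_balls intro: borel_open)
  finally show ?thesis .
qed

text \<open>Dividing by \<open>\<epsilon>\<close> to the power \<open>N - t\<close> leaves a quantity comparable with \<open>\<epsilon>\<close> to the power \<open>t - s\<close>,
  which tends to 0 for \<open>t > s\<close> and stays above \<open>c\<close> for \<open>t \<le> s\<close>. So both Minkowski contents vanish
  exactly for \<open>t > s\<close>.\<close>

lemma has_box_dim_if_volume_comparable:
  fixes A :: "'a::euclidean_space set"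
  assumes "bounded A" "0 < s" "0 < c"
    and lower: "\<forall>\<^sub>F \<epsilon> in at_right 0.
      ennreal (c * \<epsilon> powr (real DIM('a) - s)) \<le> emeasure lborel (eps_nbhd \<epsilon> A)"
    and upper: "\<forall>\<^sub>F \<epsilon> in at_right 0.
      emeasure lborel (eps_nbhd \<epsilon> A) \<le> ennreal (C * \<epsilon> powr (real DIM('a) - s))"
  shows "has_box_dim A s"
proof -
  let ?ratio = "\<lambda>t \<epsilon>. emeasure lborel (eps_nbhd \<epsilon> A) / ennreal (\<epsilon> powr (real DIM('a) - t))"
  have pos: "\<forall>\<^sub>F \<epsilon> :: real in at_right 0. 0 < \<epsilon> \<and> \<epsilon> < 1"
    by (auto simp: eventually_at_right_field intro: exI[of _ 1])
  have powers: "ennreal (K * \<epsilon> powr (real DIM('a) - s)) / ennreal (\<epsilon> powr (real DIM('a) - t))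
      = ennreal (K * \<epsilon> powr (t - s))" if "0 < \<epsilon>" "0 \<le> K" for K \<epsilon> t
  proof -
    have "\<epsilon> powr (real DIM('a) - s) / \<epsilon> powr (real DIM('a) - t) = \<epsilon> powr (t - s)"
      by (simp flip: powr_diff)
    then show ?thesis
      using that by (simp add: divide_ennreal flip: times_divide_eq_right)
  qed
  have small: "upper_minkowski_content t A = 0" if "s < t" for t
  proof -
    have ratio_le: "\<forall>\<^sub>F \<epsilon> in at_right 0. ?ratio t \<epsilon> \<le> ennreal (max 0 C * \<epsilon> powr (t - s))"
      using upper pos
    proof eventually_elim
      case (elim \<epsilon>)
      then have "emeasure lborel (eps_nbhd \<epsilon> A) \<le> ennreal (max 0 C * \<epsilon> powr (real DIM('a) - s))"
        by (elim order_trans) (intro ennreal_leI mult_right_mono, auto)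
      then have "?ratio t \<epsilon> \<le> ennreal (max 0 C * \<epsilon> powr (real DIM('a) - s))
           / ennreal (\<epsilon> powr (real DIM('a) - t))"
        by (rule divide_right_mono_ennreal)
      with elim powers[of \<epsilon> "max 0 C"] show ?case by simp
    qed
    have bound_lim: "((\<lambda>\<epsilon>. ennreal (max 0 C * \<epsilon> powr (t - s))) \<longlongrightarrow> ennreal (max 0 C * 0)) (at_right 0)"
    proof (intro tendsto_ennrealI tendsto_mult tendsto_const)
      have "((\<lambda>\<epsilon>. \<epsilon> powr (t - s)) \<longlongrightarrow> 0 powr (t - s)) (at_right 0)"
        using that pos by (intro tendsto_powr' tendsto_ident_at tendsto_const)
          (auto elim!: eventually_mono)
      then show "((\<lambda>\<epsilon>. \<epsilon> powr (t - s)) \<longlongrightarrow> 0) (at_right 0)" by simp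
    qed
    have "(?ratio t \<longlongrightarrow> 0) (at_right 0)"
    proof (rule tendsto_sandwich[OF _ ratio_le tendsto_const])
      show "\<forall>\<^sub>F \<epsilon> in at_right 0. 0 \<le> ?ratio t \<epsilon>" by simp
    qed (use bound_lim in simp)
    then show ?thesis
      unfolding upper_minkowski_content_def by (intro lim_imp_Limsup) auto
  qed
  have large: "lower_minkowski_content t A \<noteq> 0" if "t \<le> s" for t
  proof -
    have "\<forall>\<^sub>F \<epsilon> in at_right 0. ennreal c \<le> ?ratio t \<epsilon>"
      using lower pos
    proof eventually_elim
      case (elim \<epsilon>)
      have "1 \<le> \<epsilon> powr (t - s)"
        using elim that powr_mono'[of "t - s" 0 \<epsilon>] by simp
      with \<open>0 < c\<close> have "ennreal c \<le> ennreal (c * \<epsilon> powr (t - s))"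
        by (intro ennreal_leI) simp
      also have "\<dots> = ennreal (c * \<epsilon> powr (real DIM('a) - s)) / ennreal (\<epsilon> powr (real DIM('a) - t))"
        using powers elim \<open>0 < c\<close> by simp
      also have "\<dots> \<le> ?ratio t \<epsilon>"
        using elim by (intro divide_right_mono_ennreal) auto
      finally show ?case .
    qed
    then have "ennreal c \<le> lower_minkowski_content t A"
      unfolding lower_minkowski_content_def by (rule Liminf_bounded)
    with \<open>0 < c\<close> show ?thesis by auto
  qed
  have le: "lower_minkowski_content t A \<le> upper_minkowski_content t A" for t
    unfolding lower_minkowski_content_def upper_minkowski_content_def
    by (intro Liminf_le_Limsup) simp
  have dichotomy: "lower_minkowski_content t A = 0 \<longleftrightarrow> s < t" "upper_minkowski_content t A = 0 \<longleftrightarrow> s < t" for t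
    using small[of t] large[of t] le[of t] by (metis le_zero_eq not_le)+
  have "{t. 0 < t \<and> lower_minkowski_content t A = 0} = {s<..}"
    "{t. 0 < t \<and> upper_minkowski_content t A = 0} = {s<..}"
    unfolding dichotomy using \<open>0 < s\<close> by auto
  then show ?thesis
    using \<open>bounded A\<close> by (simp add: has_box_dim_def lower_box_dim_def upper_box_dim_def)
qed

section \<open>Sequences with decrements comparable to a power\<close>

text \<open>One step of the discrete analogue of solving \<open>du/dn = - u\<^sup>m\<^sup>+\<^sup>1\<close> by passing to \<open>1 / u\<^sup>m\<close>: with
  \<open>u' = u (1 - t)\<close>, where \<open>t\<close> is comparable to \<open>u\<^sup>m\<close>, the quantity \<open>1 / u\<^sup>m\<close> is multiplied by
  \<open>1 / (1 - t)\<^sup>m\<close>, which lies between \<open>1 + t\<close> and \<open>1 + 2mt\<close> as long as \<open>2mt \<le> 1\<close>. Hence it grows by an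
  amount bounded above and below.\<close>

lemma inverse_power_growth:
  fixes u u' a b :: real
  assumes "0 < u" "0 < u'" "1 \<le> m" "0 \<le> a" "2 * real m * b * u ^ m \<le> 1"
    and step: "a * u ^ Suc m \<le> u - u'" "u - u' \<le> b * u ^ Suc m"
  shows "1 / u ^ m + a \<le> 1 / u' ^ m" and "1 / u' ^ m \<le> 1 / u ^ m + 2 * real m * b"
proof -
  define t where "t = 1 - u' / u"
  have t: "u' = u * (1 - t)" and "t < 1" using assms(1,2) by (auto simp: t_def)
  have "a * u ^ m \<le> t" "t \<le> b * u ^ m"
    using step \<open>0 < u\<close> by (auto simp: t_def field_simps)
  then have "0 \<le> t" using assms by (meson mult_nonneg_nonneg order_trans zero_le_power less_imp_le)
  have pos: "0 < u ^ m" "0 < (1 - t) ^ m" using \<open>0 < u\<close> \<open>t < 1\<close> by auto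
  have "(1 + t) * (1 - t) ^ m \<le> (1 + t) * (1 - t)"
    using power_decreasing[OF \<open>1 \<le> m\<close>, of "1 - t"] \<open>0 \<le> t\<close> \<open>t < 1\<close>
    by (intro mult_left_mono) auto
  also have "\<dots> \<le> 1" by (simp add: algebra_simps)
  finally have "1 + t \<le> 1 / (1 - t) ^ m" using pos by (simp add: field_simps)
  then have "(1 + a * u ^ m) / u ^ m \<le> (1 / (1 - t) ^ m) / u ^ m"
    using \<open>a * u ^ m \<le> t\<close> pos by (intro divide_right_mono) auto
  then show "1 / u ^ m + a \<le> 1 / u' ^ m"
    using pos \<open>0 < u\<close> by (simp add: t power_mult_distrib add_divide_distrib mult.commute)
  define w where "w = real m * t"
  have w: "0 \<le> w" "2 * w \<le> 1"
  proof -
    show "0 \<le> w" using \<open>0 \<le> t\<close> by (simp add: w_def)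
    have "real m * t \<le> real m * (b * u ^ m)" using \<open>t \<le> b * u ^ m\<close> by (intro mult_left_mono) auto
    then show "2 * w \<le> 1" using assms(5) by (simp add: w_def)
  qed
  \<comment> \<open>Bernoulli bounds \<open>(1 - t)\<^sup>m\<close> below by \<open>1 - w\<close>, and \<open>1 / (1 - w) \<le> 1 + 2w\<close> because \<open>2w \<le> 1\<close>.\<close>
  have "1 \<le> (1 + 2 * w) * (1 - w)"
    using w mult_left_mono[of "2 * w" 1 w] by (simp add: algebra_simps)
  also have "\<dots> \<le> (1 + 2 * w) * (1 - t) ^ m"
    using Bernoulli_inequality[of "- t" m] \<open>t < 1\<close> w by (intro mult_left_mono) (auto simp: w_def)
  finally have "1 / (1 - t) ^ m \<le> 1 + 2 * w" using pos by (simp add: field_simps)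
  also have "\<dots> \<le> 1 + 2 * real m * b * u ^ m"
    using mult_left_mono[OF \<open>t \<le> b * u ^ m\<close>, of "real m"] by (simp add: w_def)
  finally have "(1 / (1 - t) ^ m) / u ^ m \<le> (1 + 2 * real m * b * u ^ m) / u ^ m"
    using pos by (intro divide_right_mono) auto
  then show "1 / u' ^ m \<le> 1 / u ^ m + 2 * real m * b"
    using pos \<open>0 < u\<close> by (simp add: t power_mult_distrib add_divide_distrib mult.commute)
qed

text \<open>The hypotheses concern absolute values only, so that orbits approaching 0 from one side and
  orbits alternating around 0 are treated together. The last one makes \<open>inverse_power_growth\<close>
  applicable at the first term, hence at all terms.\<close>

locale power_decay =
  fixes x :: "nat \<Rightarrow> real" and m :: nat and a b :: real
  assumes m: "1 \<le> m" and a: "0 < a"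
    and nonzero: "x n \<noteq> 0"
    and step_ge: "a * \<bar>x n\<bar> ^ Suc m \<le> \<bar>x n\<bar> - \<bar>x (Suc n)\<bar>"
    and step_le: "\<bar>x n\<bar> - \<bar>x (Suc n)\<bar> \<le> b * \<bar>x n\<bar> ^ Suc m"
    and start_small: "2 * real m * b * \<bar>x 0\<bar> ^ m \<le> 1"
begin

lemma b_pos: "0 < b"
proof -
  have "a * \<bar>x 0\<bar> ^ Suc m \<le> b * \<bar>x 0\<bar> ^ Suc m"
    using step_ge[of 0] step_le[of 0] by linarith
  then have "a \<le> b" using nonzero[of 0] by (simp del: power_Suc)
  then show ?thesis using a by simp
qed

lemma abs_strict_decreasing: "n < n' \<Longrightarrow> \<bar>x n'\<bar> < \<bar>x n\<bar>"
proof (induction n' rule: less_Suc_induct)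
  case (1 n)
  have "0 < a * \<bar>x n\<bar> ^ Suc m" using a nonzero[of n] by simp
  with step_ge[of n] show ?case by linarith
qed simp

lemma abs_le_start: "\<bar>x n\<bar> \<le> \<bar>x 0\<bar>"
  using abs_strict_decreasing[of 0 n] by (cases n) auto

text \<open>Summing the increments of \<open>inverse_power_growth\<close>: \<open>\<bar>x n\<bar>\<close> is of the exact order \<open>n\<close> to the power \<open>-1/m\<close>.
  The lower bound on \<open>1 / \<bar>x n\<bar>\<^sup>m\<close> limits how many terms are large (for coverings), the upper bound
  guarantees that many terms are large (for packings).\<close>

lemma inverse_power_bounds:
  "a * real n \<le> 1 / \<bar>x n\<bar> ^ m"
  "1 / \<bar>x n\<bar> ^ m \<le> 1 / \<bar>x 0\<bar> ^ m + 2 * real m * b * real n"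
proof -
  have "2 * real m * b * \<bar>x n\<bar> ^ m \<le> 1" for n
  proof -
    have "2 * real m * b * \<bar>x n\<bar> ^ m \<le> 2 * real m * b * \<bar>x 0\<bar> ^ m"
      using abs_le_start[of n] b_pos by (intro mult_left_mono power_mono) auto
    with start_small show ?thesis by linarith
  qed
  then have step: "1 / \<bar>x n\<bar> ^ m + a \<le> 1 / \<bar>x (Suc n)\<bar> ^ m"
    "1 / \<bar>x (Suc n)\<bar> ^ m \<le> 1 / \<bar>x n\<bar> ^ m + 2 * real m * b" for n
    using inverse_power_growth[of "\<bar>x n\<bar>" "\<bar>x (Suc n)\<bar>" m a b] m a nonzero step_ge step_le
    by auto
  show "a * real n \<le> 1 / \<bar>x n\<bar> ^ m"
  proof (induction n)
    case (Suc n)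
    with step(1)[of n] show ?case by (simp add: algebra_simps)
  qed simp
  show "1 / \<bar>x n\<bar> ^ m \<le> 1 / \<bar>x 0\<bar> ^ m + 2 * real m * b * real n"
  proof (induction n)
    case (Suc n)
    with step(2)[of n] show ?case by (simp add: algebra_simps)
  qed simp
qed

text \<open>At scale \<open>\<epsilon> = e\<^sup>m\<^sup>+\<^sup>1\<close> the terms split at \<open>\<bar>x n\<bar> = e\<close>, about where the gaps between consecutive terms
  become comparable to \<open>\<epsilon>\<close>. By \<open>inverse_power_bounds\<close> only \<open>O(1 / e\<^sup>m)\<close> terms exceed \<open>e\<close>; each of
  them is its own centre. The others are served by the points of the graph over the grid of mesh
  \<open>\<epsilon>\<close> on \<open>[-e, e]\<close>, again \<open>O(e / \<epsilon>) = O(1 / e\<^sup>m)\<close> many, because the graph is Lipschitz.\<close>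

lemma graph_covering:
  assumes lip: "1-lipschitz_on {-R..R} h" and "\<bar>x 0\<bar> \<le> R" and e: "0 < e" "e \<le> 1" "2 * e \<le> R"
  obtains P where "finite P" "real (card P) \<le> (1 / a + 5) / e ^ m"
    "\<And>n. \<exists>p\<in>P. dist (x n, h (x n)) p \<le> 2 * e ^ Suc m"
proof -
  define \<epsilon> where "\<epsilon> = e ^ Suc m"
  have \<epsilon>: "0 < \<epsilon>" "\<epsilon> \<le> e" "e / \<epsilon> = 1 / e ^ m"
    using e power_le_one[of e m] by (auto simp: \<epsilon>_def mult_left_le)
  \<comment> \<open>\<open>N\<close> bounds the indices of the terms above \<open>e\<close>. Rounding down \<open>-e / \<epsilon>\<close> may give \<open>-(M + 1)\<close>,
    which is why the grid below extends one step further to the left.\<close>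
  define N where "N = nat \<lfloor>1 / (a * e ^ m)\<rfloor>"
  define M where "M = \<lfloor>1 / e ^ m\<rfloor>"
  define P where "P = (\<lambda>n. (x n, h (x n))) ` {..N} \<union>
    (\<lambda>j. (real_of_int j * \<epsilon>, h (real_of_int j * \<epsilon>))) ` {-(M + 1)..M}"
  show thesis
  proof
    show "finite P" by (simp add: P_def)
    have "0 \<le> M" using e by (simp add: M_def)
    have "card P \<le> card {..N} + card {-(M + 1)..M}"
      unfolding P_def by (intro card_Un_le[THEN order_trans] add_mono card_image_le) auto
    then have "real (card P) \<le> real (Suc N) + real (nat (2 * M + 2))" by simp
    also have "\<dots> = real N + 2 * real_of_int M + 3" using \<open>0 \<le> M\<close> by simp
    also have "\<dots> \<le> (1 / (a * e ^ m) + 1) + (2 * (1 / e ^ m) + 2)"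
    proof -
      have "real N \<le> 1 / (a * e ^ m)" using a e by (simp add: N_def)
      moreover have "real_of_int M \<le> 1 / e ^ m" unfolding M_def by (rule of_int_floor_le)
      ultimately show ?thesis by linarith
    qed
    also have "\<dots> \<le> 1 / (a * e ^ m) + 5 / e ^ m"
      using e power_le_one[of e m] by (simp add: field_simps)
    also have "\<dots> = (1 / a + 5) / e ^ m" by (simp add: add_divide_distrib)
    finally show "real (card P) \<le> (1 / a + 5) / e ^ m" .
    fix n
    show "\<exists>p\<in>P. dist (x n, h (x n)) p \<le> 2 * e ^ Suc m"
    proof (cases "e < \<bar>x n\<bar>")
      case True
      have "a * real n \<le> 1 / e ^ m"
        using inverse_power_bounds(1)[of n] True e
        by (elim order_trans) (intro divide_left_mono power_mono, auto)
      then have "real n \<le> 1 / (a * e ^ m)" using a e by (simp add: field_simps)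
      then have "n \<le> N" unfolding N_def by linarith
      then show ?thesis using e by (intro bexI[of _ "(x n, h (x n))"]) (auto simp: P_def)
    next
      case False
      define j where "j = \<lfloor>x n / \<epsilon>\<rfloor>"
      define z where "z = real_of_int j * \<epsilon>"
      have "\<bar>x n\<bar> / \<epsilon> \<le> 1 / e ^ m"
        using False \<epsilon> divide_right_mono[of "\<bar>x n\<bar>" e \<epsilon>] by auto
      then have bound: "\<bar>x n / \<epsilon>\<bar> \<le> 1 / e ^ m" using \<epsilon> by simp
      have "j \<in> {-(M + 1)..M}"
      proof -
        have "j \<le> M" unfolding j_def M_def using bound by (intro floor_mono) linarith
        moreover have "-(M + 1) \<le> j" unfolding j_def M_def le_floor_iff using bound by linarith
        ultimately show ?thesis by simp
      qed
      then have "(z, h z) \<in> P" by (auto simp: P_def z_def)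
      moreover have dz: "\<bar>x n - z\<bar> \<le> \<epsilon>"
      proof -
        have "\<bar>x n / \<epsilon> - real_of_int j\<bar> \<le> 1" unfolding j_def by linarith
        then have "\<bar>x n / \<epsilon> - real_of_int j\<bar> * \<epsilon> \<le> \<epsilon>" using \<epsilon> by simp
        moreover have "\<bar>x n / \<epsilon> - real_of_int j\<bar> * \<epsilon> = \<bar>(x n / \<epsilon> - real_of_int j) * \<epsilon>\<bar>"
          using \<epsilon> by (simp add: abs_mult)
        ultimately show ?thesis using \<epsilon> by (simp add: left_diff_distrib z_def)
      qed
      moreover have "dist (h (x n)) (h z) \<le> 1 * dist (x n) z"
        using lip
      proof (rule lipschitz_onD)
        show "x n \<in> {-R..R}" using abs_le_start[of n] \<open>\<bar>x 0\<bar> \<le> R\<close> by auto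
        show "z \<in> {-R..R}" using dz \<epsilon> False e by auto
      qed
      moreover have "dist (x n, h (x n)) (z, h z) \<le> dist (x n) z + dist (h (x n)) (h z)"
        by (simp add: dist_Pair_Pair sqrt_sum_squares_le_sum)
      ultimately show ?thesis
        by (intro bexI[of _ "(z, h z)"]) (auto simp: dist_real_def \<epsilon>_def)
    qed
  qed
qed

text \<open>While \<open>\<bar>x n\<bar> \<ge> K e\<close> the next decrement is at least \<open>a (K e)\<^sup>m\<^sup>+\<^sup>1\<close>, and \<open>K \<ge> 1\<close>, \<open>a K \<ge> 2\<close>, so the
  absolute values of these terms are already \<open>2\<epsilon>\<close>-separated for \<open>\<epsilon> = e\<^sup>m\<^sup>+\<^sup>1\<close>. By \<open>inverse_power_bounds\<close>
  there are at least a constant times \<open>1 / e\<^sup>m\<close> of them. Passing to the graph only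
  increases the distances.\<close>

lemma graph_packing:
  defines "K \<equiv> 1 + 2 / a"
  assumes e: "0 < e" "2 * K * e \<le> \<bar>x 0\<bar>"
  obtains P where "finite P" "P \<subseteq> range (\<lambda>n. (x n, h (x n)))"
    "1 / (4 * real m * b * K ^ m) / e ^ m \<le> real (card P)"
    "\<And>p q. p \<in> P \<Longrightarrow> q \<in> P \<Longrightarrow> p \<noteq> q \<Longrightarrow> 2 * e ^ Suc m \<le> dist p q"
proof -
  define D where "D = 2 * real m * b"
  have D: "0 < D" using m b_pos by (simp add: D_def)
  have K: "1 \<le> K" "2 \<le> a * K" using a by (auto simp: K_def field_simps)
  then have Ke: "0 < K * e" using e by simp
  define T where "T = (1 / (K * e) ^ m - 1 / \<bar>x 0\<bar> ^ m) / D"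
  define N where "N = nat \<lfloor>T\<rfloor>"
  \<comment> \<open>The factor 2 in the smallness of \<open>e\<close> makes \<open>1 / \<bar>x 0\<bar>\<^sup>m\<close> at most half of \<open>1 / (K e)\<^sup>m\<close>.\<close>
  have T: "1 / (2 * D * (K * e) ^ m) \<le> T"
  proof -
    have "2 * (K * e) ^ m \<le> 2 ^ m * (K * e) ^ m"
      using power_increasing[OF m, of "2::real"] Ke by (intro mult_right_mono) auto
    also have "\<dots> = (2 * K * e) ^ m" by (simp add: power_mult_distrib)
    also have "\<dots> \<le> \<bar>x 0\<bar> ^ m" using e Ke by (intro power_mono) auto
    finally have "1 / \<bar>x 0\<bar> ^ m \<le> 1 / (2 * (K * e) ^ m)"
      using Ke nonzero[of 0] by (intro divide_left_mono) auto
    then have "1 / (2 * (K * e) ^ m) / D \<le> T"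
      unfolding T_def using D by (intro divide_right_mono) auto
    then show ?thesis by (simp add: mult.commute mult.left_commute)
  qed
  have "0 \<le> T" using T D Ke by (intro order_trans[OF _ T]) simp
  have gap: "2 * e ^ Suc m \<le> \<bar>x n\<bar> - \<bar>x n'\<bar>" if "n \<le> N" "n < n'" for n n'
  proof -
    have "real n \<le> T" using \<open>n \<le> N\<close> \<open>0 \<le> T\<close> unfolding N_def by linarith
    then have "D * real n \<le> D * T" using D by simp
    moreover have "D * T = 1 / (K * e) ^ m - 1 / \<bar>x 0\<bar> ^ m" using D by (simp add: T_def)
    ultimately have "1 / \<bar>x n\<bar> ^ m \<le> 1 / (K * e) ^ m"
      using inverse_power_bounds(2)[of n, folded D_def] by linarith
    moreover have "0 < (K * e) ^ m" "0 < \<bar>x n\<bar> ^ m" using Ke nonzero[of n] by simp_all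
    ultimately have "(K * e) ^ m \<le> \<bar>x n\<bar> ^ m"
      by (metis inverse_eq_divide inverse_le_imp_le)
    then have "K * e \<le> \<bar>x n\<bar>"
      using m power_mono_iff[of "K * e" "\<bar>x n\<bar>" m] Ke by simp
    have "2 * e ^ Suc m \<le> a * K * e ^ Suc m" using K e by (intro mult_right_mono) auto
    also have "\<dots> \<le> a * (K ^ Suc m * e ^ Suc m)"
      using a K e self_le_power[of K "Suc m"] by (simp add: mult_left_mono mult_right_mono del: power_Suc)
    also have "\<dots> \<le> a * \<bar>x n\<bar> ^ Suc m"
      unfolding power_mult_distrib[symmetric]
      using a Ke \<open>K * e \<le> \<bar>x n\<bar>\<close> by (intro mult_left_mono power_mono) auto
    also have "\<dots> \<le> \<bar>x n\<bar> - \<bar>x (Suc n)\<bar>" by (rule step_ge)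
    also have "\<dots> \<le> \<bar>x n\<bar> - \<bar>x n'\<bar>"
      using abs_strict_decreasing[of "Suc n" n'] that by (cases "n' = Suc n") auto
    finally show ?thesis .
  qed
  let ?p = "\<lambda>n. (x n, h (x n))"
  have sep: "2 * e ^ Suc m \<le> dist (?p n) (?p n')" if "n \<le> N" "n' \<le> N" "n \<noteq> n'" for n n'
  proof -
    have "2 * e ^ Suc m \<le> \<bar>\<bar>x n\<bar> - \<bar>x n'\<bar>\<bar>"
      using gap[of n n'] gap[of n' n] that by (cases "n < n'") auto
    also have "\<dots> \<le> dist (x n) (x n')" by (simp add: dist_real_def)
    also have "\<dots> \<le> dist (?p n) (?p n')" using dist_fst_le[of "?p n" "?p n'"] by simp
    finally show ?thesis .
  qed
  show thesis
  proof
    have "inj_on ?p {..N}"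
    proof (rule inj_onI)
      fix n n' assume "n \<in> {..N}" "n' \<in> {..N}" "?p n = ?p n'"
      then show "n = n'" using abs_strict_decreasing[of n n'] abs_strict_decreasing[of n' n]
        by (cases n n' rule: linorder_cases) auto
    qed
    then have "real (card (?p ` {..N})) = real (Suc N)" by (simp add: card_image)
    moreover have "T \<le> real (Suc N)" unfolding N_def by linarith
    moreover have "1 / (4 * real m * b * K ^ m) / e ^ m = 1 / (2 * D * (K * e) ^ m)"
      by (simp add: D_def power_mult_distrib mult.assoc)
    ultimately show "1 / (4 * real m * b * K ^ m) / e ^ m \<le> real (card (?p ` {..N}))"
      using T by linarith
    show "2 * e ^ Suc m \<le> dist p q" if "p \<in> ?p ` {..N}" "q \<in> ?p ` {..N}" "p \<noteq> q" for p q
      using that sep by blast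
  qed auto
qed

text \<open>With \<open>e\<close> the \<open>(m + 1)\<close>-st root of \<open>\<epsilon>\<close>, both the covering and the packing number are of order
  \<open>1 / e\<^sup>m\<close>. In the plane the \<open>\<epsilon>\<close>-neighbourhood therefore has area of order \<open>\<epsilon>\<^sup>2 / e\<^sup>m = \<epsilon> e\<close>, that is
  \<open>\<epsilon>\<close> to the power \<open>2 - s\<close> with \<open>s = 1 - 1/(m + 1)\<close>.\<close>

lemma has_box_dim_graph:
  fixes h :: "real \<Rightarrow> real"
  assumes lip: "1-lipschitz_on {-R..R} h" and "0 < R" "\<bar>x 0\<bar> \<le> R"
  shows "has_box_dim (range (\<lambda>n. (x n, h (x n)))) (1 - 1 / real (Suc m))"
proof -
  define A where "A = range (\<lambda>n. (x n, h (x n)))"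
  define s where "s = 1 - 1 / real (Suc m)"
  define V where "V = unit_ball_vol 2"
  have "0 < V" by (simp add: V_def)
  define K where "K = 1 + 2 / a"
  have "0 < K" using a by (simp add: K_def add_pos_pos)
  define c where "c = 1 / (4 * real m * b * K ^ m)"
  have "0 < c" using m b_pos \<open>0 < K\<close> by (simp add: c_def)
  define e where "e \<epsilon> = \<epsilon> powr (1 / real (Suc m))" for \<epsilon> :: real
  have e_power: "e \<epsilon> ^ Suc m = \<epsilon>" if "0 < \<epsilon>" for \<epsilon>
    unfolding e_def using that by (subst powr_realpow[symmetric]) (auto simp: powr_powr)
  have scale: "Q / e \<epsilon> ^ m * (V * (L * \<epsilon>) ^ 2) = L\<^sup>2 * Q * V * \<epsilon> powr (2 - s)"
    if "0 < \<epsilon>" for \<epsilon> Q L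
  proof -
    have "0 < e \<epsilon>" using that by (simp add: e_def)
    have "\<epsilon> powr (2 - s) = \<epsilon> * e \<epsilon>"
      using that by (simp add: s_def e_def powr_add)
    moreover have "\<epsilon> ^ 2 / e \<epsilon> ^ m = \<epsilon> * e \<epsilon>"
    proof -
      have "\<epsilon> / e \<epsilon> ^ m = e \<epsilon>"
        using e_power[OF that] \<open>0 < e \<epsilon>\<close> by (simp add: field_simps)
      then show ?thesis by (simp add: power2_eq_square flip: times_divide_eq_right)
    qed
    moreover have "Q / e \<epsilon> ^ m * (V * (L * \<epsilon>) ^ 2) = L\<^sup>2 * Q * V * (\<epsilon> ^ 2 / e \<epsilon> ^ m)"
      by (simp add: power_mult_distrib)
    ultimately show ?thesis by simp
  qed
  have "(e \<longlongrightarrow> 0 powr (1 / real (Suc m))) (at_right 0)"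
    unfolding e_def by (intro tendsto_powr' tendsto_ident_at tendsto_const)
      (auto simp: eventually_at_right_field intro: exI[of _ 1])
  then have e_lim: "(e \<longlongrightarrow> 0) (at_right 0)" by simp
  have pos: "\<forall>\<^sub>F \<epsilon> :: real in at_right 0. 0 < \<epsilon>"
    by (simp add: eventually_at_right_less)
  have "has_box_dim A s"
  proof (rule has_box_dim_if_volume_comparable)
    have "x n \<in> {-R..R}" for n
      using abs_le_start[of n] \<open>\<bar>x 0\<bar> \<le> R\<close> by auto
    then have "A \<subseteq> {-R..R} \<times> h ` {-R..R}" by (auto simp: A_def)
    moreover have "compact (h ` {-R..R})"
      by (intro compact_continuous_image lipschitz_on_continuous_on[OF lip]) auto
    ultimately show "bounded A"
      using bounded_subset[of "{-R..R} \<times> h ` {-R..R}"] by (simp add: bounded_Times compact_imp_bounded)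
    show "0 < s" using m by (simp add: s_def)
    show "0 < c * V" using \<open>0 < c\<close> \<open>0 < V\<close> by simp
    have "\<forall>\<^sub>F \<epsilon> in at_right 0. e \<epsilon> < \<bar>x 0\<bar> / (2 * K)"
      using order_tendstoD(2)[OF e_lim] nonzero[of 0] \<open>0 < K\<close> by simp
    with pos show "\<forall>\<^sub>F \<epsilon> in at_right 0.
        ennreal (c * V * \<epsilon> powr (real DIM(real \<times> real) - s)) \<le> emeasure lborel (eps_nbhd \<epsilon> A)"
    proof eventually_elim
      case (elim \<epsilon>)
      then have "0 < e \<epsilon>" "2 * K * e \<epsilon> \<le> \<bar>x 0\<bar>"
        using \<open>0 < K\<close> by (auto simp: e_def field_simps)
      from graph_packing[OF this[unfolded K_def], of h, folded K_def]
      obtain P where P: "finite P" "P \<subseteq> A" "c / e \<epsilon> ^ m \<le> real (card P)"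
        "\<And>p q. p \<in> P \<Longrightarrow> q \<in> P \<Longrightarrow> p \<noteq> q \<Longrightarrow> 2 * \<epsilon> \<le> dist p q"
        unfolding A_def c_def e_power[OF \<open>0 < \<epsilon>\<close>] by blast
      have "c * V * \<epsilon> powr (2 - s) = c / e \<epsilon> ^ m * (V * \<epsilon> ^ 2)"
        using scale[of \<epsilon> c 1] elim by simp
      also have "\<dots> \<le> real (card P) * (V * \<epsilon> ^ 2)"
        using P \<open>0 < V\<close> by (intro mult_right_mono) auto
      finally have "ennreal (c * V * \<epsilon> powr (2 - s)) \<le> ennreal (real (card P) * (V * \<epsilon> ^ 2))"
        by (rule ennreal_leI)
      also have "\<dots> \<le> emeasure lborel (eps_nbhd \<epsilon> A)"
        using emeasure_eps_nbhd_ge_packing[OF P(1,2) _ P(4)] elim by (simp add: V_def power2_eq_square)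
      finally show ?case by simp
    qed
    have "\<forall>\<^sub>F \<epsilon> in at_right 0. e \<epsilon> < min 1 (R / 2)"
      using order_tendstoD(2)[OF e_lim, of "min 1 (R / 2)"] \<open>0 < R\<close> by simp
    with pos show "\<forall>\<^sub>F \<epsilon> in at_right 0. emeasure lborel (eps_nbhd \<epsilon> A)
        \<le> ennreal (3\<^sup>2 * (1 / a + 5) * V * \<epsilon> powr (real DIM(real \<times> real) - s))"
    proof eventually_elim
      case (elim \<epsilon>)
      then have "0 < e \<epsilon>" "e \<epsilon> \<le> 1" "2 * e \<epsilon> \<le> R" by (auto simp: e_def)
      from graph_covering[OF lip \<open>\<bar>x 0\<bar> \<le> R\<close> this]
      obtain P where P: "finite P" "real (card P) \<le> (1 / a + 5) / e \<epsilon> ^ m"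
        "\<And>n. \<exists>p\<in>P. dist (x n, h (x n)) p \<le> 2 * \<epsilon>"
        unfolding e_power[OF \<open>0 < \<epsilon>\<close>] by blast
      have "emeasure lborel (eps_nbhd \<epsilon> A)
          \<le> ennreal (real (card P) * (V * (\<epsilon> + 2 * \<epsilon>) ^ 2))"
        using emeasure_eps_nbhd_le_covering[OF P(1), of \<epsilon> "2 * \<epsilon>" A] P(3) elim
        by (auto simp: V_def A_def power2_eq_square)
      also have "\<epsilon> + 2 * \<epsilon> = 3 * \<epsilon>" by simp
      also have "ennreal (real (card P) * (V * (3 * \<epsilon>) ^ 2))
          \<le> ennreal ((1 / a + 5) / e \<epsilon> ^ m * (V * (3 * \<epsilon>) ^ 2))"
        using P(2) \<open>0 < V\<close> by (intro ennreal_leI mult_right_mono) auto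
      also have "\<dots> = ennreal (3\<^sup>2 * (1 / a + 5) * V * \<epsilon> powr (real DIM(real \<times> real) - s))"
        using scale[of \<epsilon> "1 / a + 5" 3] elim by simp
      finally show ?case .
    qed
  qed
  then show ?thesis by (simp only: A_def s_def)
qed

end

section \<open>Taylor expansion of a nondegenerate map\<close>

lemma Ck_on_imp_continuous_on: "Ck_on k F S \<Longrightarrow> continuous_on S F"
  by (cases k) (auto intro!: differentiable_imp_continuous_on simp: differentiable_on_def
      differentiable_at_withinI)

text \<open>The Frechet derivative is a fixed but arbitrary function where \<open>F\<close> is not differentiable, so the
  directional derivatives of \<open>F\<close> and those obtained from \<open>deriv\<close> are known to agree on \<open>S\<close> only. This
  lemma makes that sufficient.\<close>

lemma Ck_on_cong:
  assumes "open S" "\<And>x. x \<in> S \<Longrightarrow> F x = H x" "Ck_on k F S"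
  shows "Ck_on k H S"
  using assms(2,3)
proof (induction k arbitrary: F H)
  case 0
  then show ?case using continuous_on_cong by (metis Ck_on.simps(1))
next
  case (Suc k)
  have D: "(H has_derivative frechet_derivative F (at x)) (at x)" if "x \<in> S" for x
  proof (rule has_derivative_transform_within_open[OF _ \<open>open S\<close> that])
    show "(F has_derivative frechet_derivative F (at x)) (at x)"
      using Suc.prems(2) that by (simp add: frechet_derivative_works)
  qed (use Suc.prems in auto)
  have "Ck_on k (\<lambda>x. frechet_derivative H (at x) v) S" for v
  proof (rule Suc.IH)
    show "frechet_derivative F (at x) v = frechet_derivative H (at x) v" if "x \<in> S" for x
      using frechet_derivative_at[OF D[OF that]] by simp
  qed (use Suc.prems in simp)
  moreover have "H differentiable (at x)" if "x \<in> S" for x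
    using D[OF that] differentiableI by blast
  ultimately show ?case by simp
qed

lemma Ck_on_Suc_real:
  fixes F :: "real \<Rightarrow> real"
  assumes "open S" "Ck_on (Suc k) F S"
  shows "\<And>x. x \<in> S \<Longrightarrow> (F has_real_derivative deriv F x) (at x)" and "Ck_on k (deriv F) S"
proof -
  show *: "(F has_real_derivative deriv F x) (at x)" if "x \<in> S" for x
    using assms that by (simp add: DERIV_deriv_iff_real_differentiable)
  show "Ck_on k (deriv F) S"
  proof (rule Ck_on_cong[OF \<open>open S\<close>])
    show "Ck_on k (\<lambda>x. frechet_derivative F (at x) 1) S" using assms by simp
    show "frechet_derivative F (at x) 1 = deriv F x" if "x \<in> S" for x
      using frechet_derivative_at[OF *[OF that, unfolded has_field_derivative_def]] 
      by (metis mult.right_neutral)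
  qed
qed

lemma Ck_on_funpow_deriv:
  fixes F :: "real \<Rightarrow> real"
  assumes "open S" "Ck_on k F S" "i \<le> k"
  shows "Ck_on (k - i) ((deriv ^^ i) F) S"
  using \<open>i \<le> k\<close>
proof (induction i)
  case (Suc i)
  then have "k - i = Suc (k - Suc i)" by simp
  with Suc show ?case using Ck_on_Suc_real(2)[OF \<open>open S\<close>] by fastforce
qed (use assms in simp)

text \<open>Taylor's formula with Lagrange remainder: the terms of degree 2 to \<open>k - 1\<close> vanish and \<open>q\<close> is the
  \<open>k\<close>-th derivative at an intermediate point, divided by \<open>k!\<close>. As that derivative is continuous at 0, \<open>q\<close> stays
  within half of its value \<open>b\<close> at 0, and so keeps the sign and the order of magnitude of \<open>b\<close>.\<close>

lemma nondegenerate_at_0_expansion: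
  fixes F :: "real \<Rightarrow> real"
  assumes nondeg: "nondegenerate_at k F 0"
  obtains \<rho> b where "0 < \<rho>" "b \<noteq> 0"
    "\<And>x. \<bar>x\<bar> < \<rho> \<Longrightarrow> \<exists>q. \<bar>q - b\<bar> \<le> \<bar>b\<bar> / 2 \<and> F x = deriv F 0 * x + q * x ^ k"
proof -
  from nondeg obtain \<rho> where "0 < \<rho>" and Ck: "Ck_on k F {-\<rho><..<\<rho>}" and "2 \<le> k" "F 0 = 0"
    and zero: "\<And>i. 2 \<le> i \<Longrightarrow> i < k \<Longrightarrow> (deriv ^^ i) F 0 = 0" and top: "(deriv ^^ k) F 0 \<noteq> 0"
    by (auto simp: nondegenerate_at_def)
  define b where "b = (deriv ^^ k) F 0 / fact k"
  have "b \<noteq> 0" using top by (simp add: b_def)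
  have D: "((deriv ^^ i) F has_real_derivative (deriv ^^ Suc i) F t) (at t)"
    if "i < k" "\<bar>t\<bar> < \<rho>" for i t
  proof -
    have "Ck_on (Suc (k - Suc i)) ((deriv ^^ i) F) {-\<rho><..<\<rho>}"
      using Ck_on_funpow_deriv[OF _ Ck, of i] that by (simp add: Suc_diff_Suc)
    from Ck_on_Suc_real(1)[OF _ this] that show ?thesis by (simp add: abs_less_iff)
  qed
  have "continuous_on {-\<rho><..<\<rho>} ((deriv ^^ k) F)"
    using Ck_on_funpow_deriv[OF _ Ck, of k] by simp
  then have "isCont (\<lambda>t. (deriv ^^ k) F t / fact k) 0"
    using \<open>0 < \<rho>\<close> by (intro continuous_intros) (auto simp: continuous_on_eq_continuous_at)
  then obtain \<rho>' where "0 < \<rho>'"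
    and near: "\<And>t. \<bar>t\<bar> < \<rho>' \<Longrightarrow> \<bar>(deriv ^^ k) F t / fact k - b\<bar> < \<bar>b\<bar> / 2"
    unfolding continuous_at_eps_delta using \<open>b \<noteq> 0\<close>
    by (force simp: b_def dist_real_def dest: spec[of _ "\<bar>b\<bar> / 2"])
  show thesis
  proof (rule that[of "min \<rho> \<rho>'" b])
    fix x :: real assume x: "\<bar>x\<bar> < min \<rho> \<rho>'"
    obtain t where t: "\<bar>t\<bar> \<le> \<bar>x\<bar>" and
      taylor: "F x = (\<Sum>i<k. (deriv ^^ i) F 0 / fact i * x ^ i) + (deriv ^^ k) F t / fact k * x ^ k"
      using Maclaurin_bi_le[of "\<lambda>i. (deriv ^^ i) F" F k x] D x by auto
    have "(\<Sum>i<k. (deriv ^^ i) F 0 / fact i * x ^ i) = (\<Sum>i\<in>{0, 1}. (deriv ^^ i) F 0 / fact i * x ^ i)"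
      using \<open>2 \<le> k\<close> zero by (intro sum.mono_neutral_right) (auto simp: not_less_eq_eq numeral_2_eq_2)
    also have "\<dots> = deriv F 0 * x" using \<open>F 0 = 0\<close> by simp
    finally show "\<exists>q. \<bar>q - b\<bar> \<le> \<bar>b\<bar> / 2 \<and> F x = deriv F 0 * x + q * x ^ k"
      using taylor less_imp_le[OF near[of t]] t x
      by (intro exI[of _ "(deriv ^^ k) F t / fact k"] conjI) linarith+
  qed (use \<open>0 < \<rho>\<close> \<open>0 < \<rho>'\<close> \<open>b \<noteq> 0\<close> in auto)
qed

section \<open>Dynamics on the center manifold\<close>

text \<open>The derivative of \<open>h\<close> is continuous and vanishes at 0, so it is at most 1 in absolute value near 0.\<close>

lemma C1_flat_lipschitz:
  assumes "0 < \<delta>" "1 \<le> r" "Ck_on r h {-\<delta><..<\<delta>}" "(h has_real_derivative 0) (at 0)"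
  obtains \<rho> where "0 < \<rho>" "1-lipschitz_on {-\<rho>..\<rho>} h"
proof -
  obtain r' where r': "r = Suc r'" using \<open>1 \<le> r\<close> by (cases r) auto
  have D: "(h has_real_derivative deriv h x) (at x)" if "\<bar>x\<bar> < \<delta>" for x
    using Ck_on_Suc_real(1)[OF _ assms(3)[unfolded r']] that by (simp add: abs_less_iff)
  have "continuous_on {-\<delta><..<\<delta>} (deriv h)"
    using Ck_on_Suc_real(2)[OF _ assms(3)[unfolded r']] by (auto intro: Ck_on_imp_continuous_on)
  then have "isCont (deriv h) 0" using \<open>0 < \<delta>\<close> by (auto simp: continuous_on_eq_continuous_at)
  moreover have "deriv h 0 = 0" using assms(4) by (rule DERIV_imp_deriv)
  ultimately obtain \<rho> where "0 < \<rho>" and near: "\<And>x. \<bar>x\<bar> < \<rho> \<Longrightarrow> \<bar>deriv h x\<bar> < 1"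
    unfolding continuous_at_eps_delta by (force simp: dist_real_def dest: spec[of _ 1])
  define \<sigma> where "\<sigma> = min \<rho> \<delta> / 2"
  have "0 < \<sigma>" "\<sigma> < \<rho>" "\<sigma> < \<delta>" using \<open>0 < \<rho>\<close> \<open>0 < \<delta>\<close> by (auto simp: \<sigma>_def)
  moreover have "1-lipschitz_on {-\<sigma>..\<sigma>} h"
  proof (rule bounded_derivative_imp_lipschitz)
    fix x assume "x \<in> {-\<sigma>..\<sigma>}"
    then have "\<bar>x\<bar> < \<delta>" "\<bar>x\<bar> < \<rho>" using \<open>\<sigma> < \<rho>\<close> \<open>\<sigma> < \<delta>\<close> by auto
    then show "(h has_derivative (*) (deriv h x)) (at x within {-\<sigma>..\<sigma>})"
      using D has_field_derivative_at_within has_field_derivative_def by blast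
    show "onorm ((*) (deriv h x)) \<le> 1"
      using near[OF \<open>\<bar>x\<bar> < \<rho>\<close>] by (intro onorm_bound) (auto simp: abs_mult mult_right_le_one_le mult_left_le_one_le)
  qed auto
  ultimately show thesis using that by blast
qed

text \<open>Write \<open>t' = l t (1 + z)\<close> with \<open>z = l q t\<^sup>m\<close>, \<open>\<bar>z\<bar> \<le> 1/2\<close>. Then \<open>\<bar>t'\<bar> = \<bar>t\<bar> (1 + z)\<close>, so \<open>\<bar>t'\<bar> < \<bar>t\<bar>\<close> if and only if \<open>z\<close> is
  negative, which is a matter of the sign of \<open>l b t\<^sup>m\<close>. The hypothesis \<open>l\<^sup>m = 1\<close> makes \<open>t'\<^sup>m\<close> and \<open>t\<^sup>m\<close> have
  the same sign, so the condition passes to the next point.\<close>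

lemma near_identity_step:
  fixes l b q t t' :: real
  assumes l: "\<bar>l\<bar> = 1" "l ^ m = 1" and "1 \<le> m" and "b \<noteq> 0" and q: "\<bar>q - b\<bar> \<le> \<bar>b\<bar> / 2"
    and small: "3 * \<bar>b\<bar> * \<bar>t\<bar> ^ m \<le> 1" and t': "t' = l * t + q * t ^ Suc m"
  shows "\<bar>t'\<bar> < \<bar>t\<bar> \<longleftrightarrow> l * b * t ^ m < 0"
    and "l * b * t ^ m < 0 \<Longrightarrow> l * b * t' ^ m < 0"
    and "l * b * t ^ m < 0 \<Longrightarrow> \<bar>t\<bar> - \<bar>t'\<bar> = \<bar>q\<bar> * \<bar>t\<bar> ^ Suc m"
proof -
  define z where "z = l * q * t ^ m"
  have "l * l = 1" using l(1) by (metis abs_mult_self_eq mult_1)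
  then have t'_eq: "t' = l * t * (1 + z)"
    by (simp add: t' z_def algebra_simps)
  have abs_z: "\<bar>z\<bar> = \<bar>q\<bar> * \<bar>t\<bar> ^ m" using l(1) by (simp add: z_def abs_mult power_abs)
  have "\<bar>q\<bar> \<le> 3 / 2 * \<bar>b\<bar>" using q by linarith
  then have "\<bar>q\<bar> * \<bar>t\<bar> ^ m \<le> 3 / 2 * \<bar>b\<bar> * \<bar>t\<bar> ^ m" by (intro mult_right_mono) auto
  with small abs_z have "\<bar>z\<bar> \<le> 1 / 2" by linarith
  then have abs_t': "\<bar>t'\<bar> = \<bar>t\<bar> * (1 + z)" using l(1) by (simp add: t'_eq abs_mult)
  have "0 < q / b"
    using q \<open>b \<noteq> 0\<close> unfolding zero_less_divide_iff by linarith
  moreover have "z = q / b * (l * b * t ^ m)" using \<open>b \<noteq> 0\<close> by (simp add: z_def)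
  ultimately have sign: "z < 0 \<longleftrightarrow> l * b * t ^ m < 0"
    by (metis mult_less_0_iff not_less_iff_gr_or_eq)
  have "z = 0" if "t = 0" using that \<open>1 \<le> m\<close> by (simp add: z_def)
  then show "\<bar>t'\<bar> < \<bar>t\<bar> \<longleftrightarrow> l * b * t ^ m < 0"
    unfolding sign[symmetric] abs_t' by (cases "t = 0") auto
  assume neg: "l * b * t ^ m < 0"
  have "t' ^ m = t ^ m * (1 + z) ^ m" by (simp add: t'_eq power_mult_distrib l(2))
  moreover have "0 < (1 + z) ^ m" using \<open>\<bar>z\<bar> \<le> 1 / 2\<close> by simp
  ultimately show "l * b * t' ^ m < 0"
    using neg mult_neg_pos[of "l * b * t ^ m" "(1 + z) ^ m"] by (simp add: mult.assoc)
  have "\<bar>t\<bar> - \<bar>t'\<bar> = \<bar>t\<bar> * \<bar>z\<bar>" using neg sign abs_t' by (simp add: algebra_simps)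
  then show "\<bar>t\<bar> - \<bar>t'\<bar> = \<bar>q\<bar> * \<bar>t\<bar> ^ Suc m" by (simp add: abs_z)
qed

text \<open>The chain rule along the curve \<open>x \<mapsto> (x, h x)\<close>: since the derivative of \<open>f\<close> at the origin is 0, only the
  linear term contributes.\<close>

lemma reduced_map_deriv:
  assumes "(f has_derivative (\<lambda>_. 0)) (at (0, 0))" "h 0 = 0" "(h has_real_derivative 0) (at 0)"
  shows "deriv (\<lambda>x. l * x + f (x, h x)) (0::real) = (l::real)"
proof -
  have "((\<lambda>x. (x, h x)) has_derivative (\<lambda>d. (d, 0 * d))) (at 0)"
    using assms(3) unfolding has_field_derivative_def
    by (intro has_derivative_Pair has_derivative_ident)
  from has_derivative_compose[OF this, of f "\<lambda>_. 0"] assms(1,2)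
  have "((\<lambda>x. f (x, h x)) has_derivative (\<lambda>_. 0)) (at 0)" by simp
  then have "((\<lambda>x. f (x, h x)) has_real_derivative 0) (at 0)"
    by (rule has_derivative_imp_has_field_derivative) simp
  then have "((\<lambda>x. l * x + f (x, h x)) has_real_derivative l) (at 0)"
    by (auto intro!: derivative_eq_intros)
  then show ?thesis by (rule DERIV_imp_deriv)
qed

theorem theorem1:
  fixes l1 l2 \<delta> :: real
    and f g :: "real \<times> real \<Rightarrow> real"
    and U :: "(real \<times> real) set"
    and h G :: "real \<Rightarrow> real"
    and r k :: nat
  assumes "l1 = 1 \<or> l1 = -1" and "\<bar>l2\<bar> < 1"
    and "open U" and "(0, 0) \<in> U"
    and "1 \<le> r" and "Ck_on r f U" and "Ck_on r g U"
    and "f (0, 0) = 0" and "g (0, 0) = 0"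
    and "(f has_derivative (\<lambda>_. 0)) (at (0, 0))"
    and "(g has_derivative (\<lambda>_. 0)) (at (0, 0))"
    and "local_center_manifold r (planar_map l1 l2 f g) \<delta> h"
    and "\<And>x. \<bar>x\<bar> < \<delta> \<Longrightarrow> (x, h x) \<in> U"
    and "\<And>x. G x = l1 * x + f (x, h x)"
    and "nondegenerate_at k G 0"
    and "l1 = -1 \<Longrightarrow> odd k"
  shows "\<exists>R>0. \<forall>x y :: nat \<Rightarrow> real.
           \<bar>x 1\<bar> < R \<and> \<bar>G (x 1)\<bar> < \<bar>x 1\<bar> \<and> y 1 = h (x 1) \<and>
           (\<forall>n\<ge>1. x (Suc n) = l1 * x n + f (x n, h (x n)) \<and> y (Suc n) = h (x (Suc n)))
           \<longrightarrow> has_box_dim {(x n, y n) | n. 1 \<le> n} (1 - 1 / real k)"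
proof -
  have manifold: "0 < \<delta>" "Ck_on r h {-\<delta><..<\<delta>}" "h 0 = 0" "(h has_real_derivative 0) (at 0)"
    using assms(12) by (auto simp: local_center_manifold_def)
  from C1_flat_lipschitz[OF manifold(1) assms(5) manifold(2,4)]
  obtain \<rho>\<^sub>h where h: "0 < \<rho>\<^sub>h" "1-lipschitz_on {-\<rho>\<^sub>h..\<rho>\<^sub>h} h" .
  have "deriv G 0 = l1"
    using reduced_map_deriv[OF assms(10) manifold(3,4), of l1] assms(14) by presburger
  with nondegenerate_at_0_expansion[OF assms(15)]
  obtain \<rho> b where "0 < \<rho>" "b \<noteq> 0"
    and G: "\<And>x. \<bar>x\<bar> < \<rho> \<Longrightarrow> \<exists>q. \<bar>q - b\<bar> \<le> \<bar>b\<bar> / 2 \<and> G x = l1 * x + q * x ^ k"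
    by metis
  obtain m where k: "k = Suc m" and m: "1 \<le> m"
    using assms(15) by (cases k) (auto simp: nondegenerate_at_def)
  have l1: "\<bar>l1\<bar> = 1" "l1 ^ m = 1" using assms(1,16) by (auto simp: k)
  \<comment> \<open>The last bound on \<open>R\<close> provides the smallness hypotheses of \<open>near_identity_step\<close> and of
    \<open>power_decay\<close>; it may be stated for \<open>R\<close> in place of \<open>R\<^sup>m\<close> because \<open>R \<le> 1\<close>.\<close>
  define R where "R = Min {\<rho>, \<rho>\<^sub>h, 1, 1 / (3 * real m * \<bar>b\<bar>)}"
  have R: "0 < R" "R \<le> \<rho>" "R \<le> \<rho>\<^sub>h" "R \<le> 1" "R \<le> 1 / (3 * real m * \<bar>b\<bar>)"
    using \<open>0 < \<rho>\<close> \<open>0 < \<rho>\<^sub>h\<close> \<open>b \<noteq> 0\<close> m by (auto simp: R_def)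
  have small: "3 * real m * \<bar>b\<bar> * \<bar>t\<bar> ^ m \<le> 1" if "\<bar>t\<bar> < R" for t
  proof -
    have "\<bar>t\<bar> ^ m \<le> \<bar>t\<bar>" using power_decreasing[OF m, of "\<bar>t\<bar>"] that R by simp
    then have "3 * real m * \<bar>b\<bar> * \<bar>t\<bar> ^ m \<le> 3 * real m * \<bar>b\<bar> * (1 / (3 * real m * \<bar>b\<bar>))"
      using that R by (intro mult_left_mono) auto
    also have "\<dots> = 1" using m \<open>b \<noteq> 0\<close> by simp
    finally show ?thesis .
  qed
  have step: "(\<bar>G t\<bar> < \<bar>t\<bar> \<longleftrightarrow> l1 * b * t ^ m < 0) \<and>
      (l1 * b * t ^ m < 0 \<longrightarrow> l1 * b * G t ^ m < 0 \<and>
         \<bar>b\<bar> / 2 * \<bar>t\<bar> ^ Suc m \<le> \<bar>t\<bar> - \<bar>G t\<bar> \<and> \<bar>t\<bar> - \<bar>G t\<bar> \<le> 3 / 2 * \<bar>b\<bar> * \<bar>t\<bar> ^ Suc m)"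
    if "\<bar>t\<bar> < R" for t
  proof -
    from that R(2) have "\<bar>t\<bar> < \<rho>" by linarith
    from G[OF this, unfolded k] obtain q where q: "\<bar>q - b\<bar> \<le> \<bar>b\<bar> / 2" and Gt: "G t = l1 * t + q * t ^ Suc m"
      by blast
    have "3 * \<bar>b\<bar> * \<bar>t\<bar> ^ m \<le> 3 * real m * \<bar>b\<bar> * \<bar>t\<bar> ^ m"
      using m by (intro mult_right_mono) auto
    with small[OF that] have "3 * \<bar>b\<bar> * \<bar>t\<bar> ^ m \<le> 1" by linarith
    note dynamics = near_identity_step[OF l1 m \<open>b \<noteq> 0\<close> q this Gt]
    have "\<bar>b\<bar> / 2 \<le> \<bar>q\<bar>" "\<bar>q\<bar> \<le> 3 / 2 * \<bar>b\<bar>" using q by linarith+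
    then have "\<bar>b\<bar> / 2 * \<bar>t\<bar> ^ Suc m \<le> \<bar>q\<bar> * \<bar>t\<bar> ^ Suc m"
      "\<bar>q\<bar> * \<bar>t\<bar> ^ Suc m \<le> 3 / 2 * \<bar>b\<bar> * \<bar>t\<bar> ^ Suc m"
      by (intro mult_right_mono; simp)+
    with dynamics show ?thesis by metis
  qed
  have "has_box_dim {(x n, y n) | n. 1 \<le> n} (1 - 1 / real k)"
    if start: "\<bar>x 1\<bar> < R" "\<bar>G (x 1)\<bar> < \<bar>x 1\<bar>" "y 1 = h (x 1)"
      and orbit: "\<And>n. 1 \<le> n \<Longrightarrow> x (Suc n) = l1 * x n + f (x n, h (x n)) \<and> y (Suc n) = h (x (Suc n))"
    for x y :: "nat \<Rightarrow> real"
  proof -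
    \<comment> \<open>The orbit is indexed from 1, a \<open>power_decay\<close> sequence from 0.\<close>
    define X where "X n = x (Suc n)" for n
    have X_Suc: "X (Suc n) = G (X n)" for n using orbit[of "Suc n"] assms(14) by (simp add: X_def)
    have inv: "\<bar>X n\<bar> < R \<and> l1 * b * X n ^ m < 0" for n
    proof (induction n)
      case 0
      then show ?case using start step[of "x 1"] by (simp add: X_def)
    next
      case (Suc n)
      with step[of "X n"] show ?case by (auto simp: X_Suc)
    qed
    interpret power_decay X m "\<bar>b\<bar> / 2" "3 / 2 * \<bar>b\<bar>"
    proof
      show "X n \<noteq> 0" for n using inv[of n] m by (auto simp: zero_power Suc_le_eq)
      show "2 * real m * (3 / 2 * \<bar>b\<bar>) * \<bar>X 0\<bar> ^ m \<le> 1" using small[of "X 0"] inv[of 0] by (simp add: ac_simps)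
    qed (use m \<open>b \<noteq> 0\<close> step inv X_Suc in auto)
    have "y n = h (x n)" if "1 \<le> n" for n
      using that start(3) orbit[of "n - 1"] by (cases "n = 1") auto
    then have "{(x n, y n) | n. 1 \<le> n} = range (\<lambda>n. (X n, h (X n)))"
      unfolding X_def by (auto simp: image_iff) (metis Suc_le_D One_nat_def)
    moreover have "\<bar>X 0\<bar> \<le> \<rho>\<^sub>h" using inv[of 0] R by linarith
    ultimately show ?thesis using has_box_dim_graph[OF h(2,1)] k by simp
  qed
  with \<open>0 < R\<close> show ?thesis by blast
qed

end
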